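(* Let $\mathcal{W}$ be the planar Galilean conformal algebra over $\mathbb{C}$, with Lie bracket $[\cdot,\cdot]$. Every transposed Poisson structure on $\mathcal{W}$ is trivial; that is, if $\cdot:\mathcal{W}\times\mathcal{W}\to\mathcal{W}$ is a bilinear, commutative and associative operation such that $2z\cdot[x,y]=[z\cdot x,y]+[x,z\cdot y]$ for all $x,y,z\in\mathcal{W}$, then $x\cdot y=0$ for all $x,y\in\mathcal{W}$.
   Context: All vector spaces are over $\mathbb{C}$. The planar Galilean conformal algebra $\mathcal{W}$ is the infinite-dimensional complex Lie algebra with basis $\{L_m, H_m, I_m, J_m \mid m\in\mathbb{Z}\}$ and Lie bracket determined, by bilinearity and skew-symmetry, by the following relations for all $m,n\in\mathbb{Z}$ (all other brackets of basis elements are zero): $[L_m,L_n]=(m-n)L_{m+n}$, $[L_m,H_n]=-nH_{m+n}$, $[L_m,I_n]=(m-n)I_{m+n}$, $[L_m,J_n]=(m-n)J_{m+n}$, $[H_m,I_n]=J_{m+n}$, $[H_m,J_n]=-I_{m+n}$. A transposed Poisson structure on a Lie algebra $(L,[\cdot,\cdot])$ is a bilinear operation $\cdot$ on $L$ such that $(L,\cdot)$ is a commutative associative algebra (not assumed unital) and $2z\cdot[x,y]=[z\cdot x,y]+[x,z\cdot y]$ for all $x,y,z\in L$. It is called trivial if $x\cdot y=0$ for all $x,y\in L$. *)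

theory Defs
  imports Complex_Main "HOL-Library.Poly_Mapping"
begin

definition bilinear_op ::
  "('f::field \<Rightarrow> 'v::ab_group_add \<Rightarrow> 'v) \<Rightarrow> ('v \<Rightarrow> 'v \<Rightarrow> 'v) \<Rightarrow> bool"
  where
  "bilinear_op scale f \<longleftrightarrow>
     (\<forall>x. Vector_Spaces.linear scale scale (\<lambda>y. f x y)) \<and>
     (\<forall>y. Vector_Spaces.linear scale scale (\<lambda>x. f x y))"

locale lie_algebra = vector_space scale
  for scale :: "'f::field \<Rightarrow> 'v::ab_group_add \<Rightarrow> 'v" +
  fixes bracket :: "'v \<Rightarrow> 'v \<Rightarrow> 'v"
  assumes bracket_bilinear: "bilinear_op scale bracket"
    and bracket_self: "bracket x x = 0"
    and jacobi: "bracket x (bracket y z) + bracket y (bracket z x) + bracket z (bracket x y) = 0"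

locale transposed_poisson_structure = lie_algebra scale bracket
  for scale :: "'f::field \<Rightarrow> 'v::ab_group_add \<Rightarrow> 'v"
    and bracket :: "'v \<Rightarrow> 'v \<Rightarrow> 'v" +
  fixes dot :: "'v \<Rightarrow> 'v \<Rightarrow> 'v"
  assumes dot_bilinear: "bilinear_op scale dot"
    and dot_commute: "dot x y = dot y x"
    and dot_assoc: "dot (dot x y) z = dot x (dot y z)"
    and transposed_leibniz:
      "scale 2 (dot z (bracket x y)) = bracket (dot z x) y + bracket x (dot z y)"

definition trivial_product :: "('v::zero \<Rightarrow> 'v \<Rightarrow> 'v) \<Rightarrow> bool" where
  "trivial_product dot \<longleftrightarrow> (\<forall>x y. dot x y = 0)"


text \<open>
  The underlying vector space of the planar Galilean conformal algebra consists of the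
  finitely supported complex-valued functions on the set of basis symbols.
\<close>

datatype pgca_basis = Lb int | Hb int | Ib int | Jb int

type_synonym pgca = "pgca_basis \<Rightarrow>\<^sub>0 complex"

definition pgca_scale :: "complex \<Rightarrow> pgca \<Rightarrow> pgca" where
  "pgca_scale c x = Poly_Mapping.map ((*) c) x"

abbreviation Lg :: "int \<Rightarrow> pgca" where "Lg m \<equiv> Poly_Mapping.single (Lb m) 1"
abbreviation Hg :: "int \<Rightarrow> pgca" where "Hg m \<equiv> Poly_Mapping.single (Hb m) 1"
abbreviation Ig :: "int \<Rightarrow> pgca" where "Ig m \<equiv> Poly_Mapping.single (Ib m) 1"
abbreviation Jg :: "int \<Rightarrow> pgca" where "Jg m \<equiv> Poly_Mapping.single (Jb m) 1"

text \<open>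
  The six defining relations, their mirror images under skew-symmetry, and the four
  families of vanishing brackets.
\<close>

fun pgca_basis_bracket :: "pgca_basis \<Rightarrow> pgca_basis \<Rightarrow> pgca" where
  "pgca_basis_bracket (Lb m) (Lb n) = pgca_scale (of_int (m - n)) (Lg (m + n))"
| "pgca_basis_bracket (Lb m) (Hb n) = pgca_scale (- of_int n) (Hg (m + n))"
| "pgca_basis_bracket (Lb m) (Ib n) = pgca_scale (of_int (m - n)) (Ig (m + n))"
| "pgca_basis_bracket (Lb m) (Jb n) = pgca_scale (of_int (m - n)) (Jg (m + n))"
| "pgca_basis_bracket (Hb m) (Ib n) = Jg (m + n)"
| "pgca_basis_bracket (Hb m) (Jb n) = - Ig (m + n)"
| "pgca_basis_bracket (Hb m) (Lb n) = - pgca_scale (- of_int m) (Hg (n + m))"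
| "pgca_basis_bracket (Ib m) (Lb n) = - pgca_scale (of_int (n - m)) (Ig (n + m))"
| "pgca_basis_bracket (Jb m) (Lb n) = - pgca_scale (of_int (n - m)) (Jg (n + m))"
| "pgca_basis_bracket (Ib m) (Hb n) = - Jg (n + m)"
| "pgca_basis_bracket (Jb m) (Hb n) = Ig (n + m)"
| "pgca_basis_bracket (Hb m) (Hb n) = 0"
| "pgca_basis_bracket (Ib m) (Ib n) = 0"
| "pgca_basis_bracket (Jb m) (Jb n) = 0"
| "pgca_basis_bracket (Ib m) (Jb n) = 0"
| "pgca_basis_bracket (Jb m) (Ib n) = 0"

definition pgca_bracket :: "pgca \<Rightarrow> pgca \<Rightarrow> pgca" where
  "pgca_bracket x y =
     (\<Sum>a\<in>Poly_Mapping.keys x. \<Sum>b\<in>Poly_Mapping.keys y.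
        pgca_scale (Poly_Mapping.lookup x a * Poly_Mapping.lookup y b) (pgca_basis_bracket a b))"

lemma lookup_pgca_scale [simp]:
  "Poly_Mapping.lookup (pgca_scale c x) k = c * Poly_Mapping.lookup x k"
  unfolding pgca_scale_def by transfer (auto simp: when_def)

lemma pgca_scale_single [simp]:
  "pgca_scale c (Poly_Mapping.single a d) = Poly_Mapping.single a (c * d)"
  by (rule poly_mapping_eqI) (auto simp: lookup_single when_def)

interpretation pgca: vector_space pgca_scale
  by unfold_locales (auto intro!: poly_mapping_eqI simp: lookup_add algebra_simps)

lemma keys_pgca_scale: "Poly_Mapping.keys (pgca_scale c x) \<subseteq> Poly_Mapping.keys x"
  by (auto simp: in_keys_iff)

lemma pgca_bracket_superset:
  assumes "finite A" "finite B" "Poly_Mapping.keys x \<subseteq> A" "Poly_Mapping.keys y \<subseteq> B"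
  shows "pgca_bracket x y =
     (\<Sum>a\<in>A. \<Sum>b\<in>B.
        pgca_scale (Poly_Mapping.lookup x a * Poly_Mapping.lookup y b) (pgca_basis_bracket a b))"
proof -
  let ?g = "\<lambda>a b. pgca_scale (Poly_Mapping.lookup x a * Poly_Mapping.lookup y b)
                    (pgca_basis_bracket a b)"
  have "(\<Sum>b\<in>Poly_Mapping.keys y. ?g a b) = (\<Sum>b\<in>B. ?g a b)" for a
    by (rule sum.mono_neutral_left) (use assms in \<open>auto simp: in_keys_iff\<close>)
  moreover have "(\<Sum>a\<in>Poly_Mapping.keys x. \<Sum>b\<in>B. ?g a b) = (\<Sum>a\<in>A. \<Sum>b\<in>B. ?g a b)"
    by (rule sum.mono_neutral_left) (use assms in \<open>auto simp: in_keys_iff\<close>)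
  ultimately show ?thesis by (simp add: pgca_bracket_def)
qed

lemma pgca_bracket_add_left: "pgca_bracket (x + y) z = pgca_bracket x z + pgca_bracket y z"
proof -
  define A where "A = Poly_Mapping.keys x \<union> Poly_Mapping.keys y"
  have A: "finite A" "Poly_Mapping.keys x \<subseteq> A" "Poly_Mapping.keys y \<subseteq> A"
    "Poly_Mapping.keys (x + y) \<subseteq> A"
    using keys_add[of x y] by (auto simp: A_def)
  show ?thesis
    unfolding pgca_bracket_superset[OF A(1) finite_keys A(2) order.refl]
      pgca_bracket_superset[OF A(1) finite_keys A(3) order.refl]
      pgca_bracket_superset[OF A(1) finite_keys A(4) order.refl]
    by (simp add: lookup_add distrib_right pgca.scale_left_distrib sum.distrib)
qed

lemma pgca_bracket_add_right: "pgca_bracket z (x + y) = pgca_bracket z x + pgca_bracket z y"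
proof -
  define A where "A = Poly_Mapping.keys x \<union> Poly_Mapping.keys y"
  have A: "finite A" "Poly_Mapping.keys x \<subseteq> A" "Poly_Mapping.keys y \<subseteq> A"
    "Poly_Mapping.keys (x + y) \<subseteq> A"
    using keys_add[of x y] by (auto simp: A_def)
  show ?thesis
    unfolding pgca_bracket_superset[OF finite_keys A(1) order.refl A(2)]
      pgca_bracket_superset[OF finite_keys A(1) order.refl A(3)]
      pgca_bracket_superset[OF finite_keys A(1) order.refl A(4)]
    by (simp add: lookup_add distrib_left pgca.scale_left_distrib sum.distrib)
qed

lemma pgca_bracket_scale_left: "pgca_bracket (pgca_scale c x) z = pgca_scale c (pgca_bracket x z)"
  unfolding pgca_bracket_superset[OF finite_keys finite_keys keys_pgca_scale order.refl]
    pgca_bracket_def[of x]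
  by (simp add: pgca.scale_sum_right mult.assoc)

lemma pgca_bracket_scale_right: "pgca_bracket z (pgca_scale c x) = pgca_scale c (pgca_bracket z x)"
  unfolding pgca_bracket_superset[OF finite_keys finite_keys order.refl keys_pgca_scale]
    pgca_bracket_def[of _ x]
  by (simp add: pgca.scale_sum_right mult.assoc mult.left_commute)

lemma pgca_bracket_single [simp]:
  "pgca_bracket (Poly_Mapping.single a c) (Poly_Mapping.single b d) =
     pgca_scale (c * d) (pgca_basis_bracket a b)"
  by (subst pgca_bracket_superset[of "{a}" "{b}"]) auto

lemma pgca_bracket_zero [simp]: "pgca_bracket 0 x = 0" "pgca_bracket x 0 = 0"
  by (simp_all add: pgca_bracket_def)

lemma pgca_bracket_minus [simp]:
  "pgca_bracket (- x) y = - pgca_bracket x y" "pgca_bracket x (- y) = - pgca_bracket x y"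
  using pgca_bracket_scale_left[of "-1" x y] pgca_bracket_scale_right[of x "-1" y] by simp_all

lemma pgca_bilinear: "bilinear_op pgca_scale pgca_bracket"
  by (auto simp: bilinear_op_def Vector_Spaces.linear_iff pgca.vector_space_axioms
      pgca_bracket_add_left pgca_bracket_add_right
      pgca_bracket_scale_left pgca_bracket_scale_right)

lemma pgca_relations:
  "pgca_bracket (Lg m) (Lg n) = pgca_scale (of_int (m - n)) (Lg (m + n))"
  "pgca_bracket (Lg m) (Hg n) = pgca_scale (- of_int n) (Hg (m + n))"
  "pgca_bracket (Lg m) (Ig n) = pgca_scale (of_int (m - n)) (Ig (m + n))"
  "pgca_bracket (Lg m) (Jg n) = pgca_scale (of_int (m - n)) (Jg (m + n))"
  "pgca_bracket (Hg m) (Ig n) = Jg (m + n)"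
  "pgca_bracket (Hg m) (Jg n) = - Ig (m + n)"
  "pgca_bracket (Hg m) (Hg n) = 0"
  "pgca_bracket (Ig m) (Ig n) = 0"
  "pgca_bracket (Ig m) (Jg n) = 0"
  "pgca_bracket (Jg m) (Jg n) = 0"
  by simp_all

lemma pgca_induct [case_names single add]:
  fixes x :: pgca
  assumes single: "\<And>a c. P (Poly_Mapping.single a c)"
    and add: "\<And>x y. P x \<Longrightarrow> P y \<Longrightarrow> P (x + y)"
  shows "P x"
proof (induction x rule: update_induct)
  case const
  show ?case using single[of _ 0] by simp
next
  case (update f a b)
  have "Poly_Mapping.update a b f = f + Poly_Mapping.single a b"
    by (rule poly_mapping_eqI)
      (use update in \<open>auto simp: lookup_update lookup_add lookup_single when_def in_keys_iff\<close>)
  with update add single show ?case by simp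
qed

lemma pgca_basis_bracket_skew: "pgca_basis_bracket a b = - pgca_basis_bracket b a"
  by (cases a; cases b)
    (auto intro!: poly_mapping_eqI simp: lookup_uminus lookup_single when_def algebra_simps)

lemma pgca_bracket_skew: "pgca_bracket x y = - pgca_bracket y x"
proof (induction x rule: pgca_induct)
  case (single a c)
  show ?case
  proof (induction y rule: pgca_induct)
    case (single b d)
    show ?case by (simp add: pgca_basis_bracket_skew[of a b] mult.commute)
  qed (simp add: pgca_bracket_add_left pgca_bracket_add_right)
qed (simp add: pgca_bracket_add_left pgca_bracket_add_right)

lemma pgca_jacobi_basis:
  "pgca_bracket (Poly_Mapping.single a p) (pgca_bracket (Poly_Mapping.single b q) (Poly_Mapping.single c r)) +
   pgca_bracket (Poly_Mapping.single b q) (pgca_bracket (Poly_Mapping.single c r) (Poly_Mapping.single a p)) +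
   pgca_bracket (Poly_Mapping.single c r) (pgca_bracket (Poly_Mapping.single a p) (Poly_Mapping.single b q)) = 0"
  by (cases a; cases b; cases c; rule poly_mapping_eqI)
    (auto simp: pgca_bracket_scale_right lookup_add lookup_minus lookup_uminus lookup_single when_def algebra_simps)

lemma pgca_jacobi:
  "pgca_bracket x (pgca_bracket y z) + pgca_bracket y (pgca_bracket z x) +
   pgca_bracket z (pgca_bracket x y) = 0"
proof (induction x rule: pgca_induct)
  case (single a p)
  show ?case
  proof (induction y rule: pgca_induct)
    case (single b q)
    show ?case
    proof (induction z rule: pgca_induct)
      case (single c r)
      show ?case by (rule pgca_jacobi_basis)
    next
      case (add x y)
      from arg_cong2[OF this, of "(+)"] show ?case
        by (simp add: pgca_bracket_add_left pgca_bracket_add_right algebra_simps)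
    qed
  next
    case (add x y)
    from arg_cong2[OF this, of "(+)"] show ?case
      by (simp add: pgca_bracket_add_left pgca_bracket_add_right algebra_simps)
  qed
next
  case (add x y)
  from arg_cong2[OF this, of "(+)"] show ?case
    by (simp add: pgca_bracket_add_left pgca_bracket_add_right algebra_simps)
qed

interpretation pgca: lie_algebra pgca_scale pgca_bracket
proof
  fix x :: pgca
  show "pgca_bracket x x = 0"
  proof (rule poly_mapping_eqI)
    fix k
    show "Poly_Mapping.lookup (pgca_bracket x x) k = Poly_Mapping.lookup 0 k"
      using arg_cong[OF pgca_bracket_skew[of x x], of "\<lambda>u. Poly_Mapping.lookup u k"] by (simp add: lookup_uminus)
  qed
qed (fact pgca_bilinear pgca_jacobi)+

end

theory Submission
  imports Defs
begin

text \<open>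
  For a fixed element \<open>z\<close>, left multiplication \<open>\<phi> = dot z\<close> is a \<^emph>\<open>half-derivation\<close>:
  \<open>2 \<phi>[x,y] = [\<phi> x, y] + [x, \<phi> y]\<close>.  The whole proof consists in showing that the only
  half-derivations of the planar Galilean conformal algebra are the multiples of the identity
  (lemma \<open>half_derivation_is_scalar\<close>).  Given this, \<open>dot z x\<close> is a multiple of \<open>x\<close> and, by
  commutativity, also a multiple of \<open>z\<close>; since the algebra has dimension at least two, this
  forces the product to vanish.

  The algebra is graded by the index of the basis symbols, and \<open>L\<^sub>0\<close> acts on degree \<open>n\<close> by
  \<open>-n\<close>.  Applying the half-derivation identity to \<open>L\<^sub>0\<close> and a basis vector \<open>X\<^sub>n\<close> of degree \<open>n\<close>
  gives, for the component in degree \<open>j\<close>,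
  \<open>(j - 2 n) (\<phi> X\<^sub>n)\<^sub>j = [\<phi> L\<^sub>0, X\<^sub>n]\<^sub>j\<close>.
  At the resonant degree \<open>j = 2 n\<close> the left side vanishes, so the right side has to vanish as
  well.  Letting \<open>X\<^sub>n\<close> run through the four families, these resonance conditions kill every
  coefficient of \<open>\<phi> L\<^sub>0\<close> except that of \<open>L\<^sub>0\<close> itself (lemma \<open>half_derivation_L0\<close>).

  Subtracting a multiple of the identity leaves a half-derivation with \<open>\<phi> L\<^sub>0 = 0\<close>.  The same
  identity now says that it doubles degrees.  But then the three terms of
  \<open>2 \<phi>[L\<^sub>m,X\<^sub>n] = [\<phi> L\<^sub>m, X\<^sub>n] + [L\<^sub>m, \<phi> X\<^sub>n]\<close> live in the degrees \<open>2 m + 2 n\<close>, \<open>2 m + n\<close> and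
  \<open>m + 2 n\<close>.  If \<open>m\<close> and \<open>n\<close> are nonzero, the first degree differs from the other two, whence
  \<open>\<phi>[L\<^sub>m,X\<^sub>n] = 0\<close>; brackets of this kind span the algebra.
\<close>

section \<open>The grading\<close>

fun degree :: "pgca_basis \<Rightarrow> int" where
  "degree (Lb m) = m"
| "degree (Hb m) = m"
| "degree (Ib m) = m"
| "degree (Jb m) = m"

definition homogeneous :: "int \<Rightarrow> pgca \<Rightarrow> bool" where
  "homogeneous d x \<longleftrightarrow> (\<forall>b. degree b \<noteq> d \<longrightarrow> Poly_Mapping.lookup x b = 0)"

lemma homogeneous_sum:
  "(\<And>i. i \<in> A \<Longrightarrow> homogeneous d (f i)) \<Longrightarrow> homogeneous d (\<Sum>i\<in>A. f i)"
  by (simp add: homogeneous_def lookup_sum)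

lemma homogeneous_basis_bracket: "homogeneous (degree a + degree b) (pgca_basis_bracket a b)"
  by (cases a; cases b) (auto simp: homogeneous_def lookup_single when_def)

lemma homogeneous_bracket:
  assumes "homogeneous d x" and "homogeneous e y"
  shows "homogeneous (d + e) (pgca_bracket x y)"
  unfolding pgca_bracket_def
proof (intro homogeneous_sum)
  fix a b assume "a \<in> Poly_Mapping.keys x" "b \<in> Poly_Mapping.keys y"
  then have "degree a = d" "degree b = e"
    using assms by (auto simp: homogeneous_def in_keys_iff)
  then show "homogeneous (d + e) (pgca_scale
      (Poly_Mapping.lookup x a * Poly_Mapping.lookup y b) (pgca_basis_bracket a b))"
    using homogeneous_basis_bracket[of a b] by (simp add: homogeneous_def)
qed

lemma homogeneous_single: "homogeneous (degree a) (Poly_Mapping.single a c)"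
  by (auto simp: homogeneous_def lookup_single when_def)

lemma lookup_bracket_L0:
  "Poly_Mapping.lookup (pgca_bracket (Lg 0) y) b = - of_int (degree b) * Poly_Mapping.lookup y b"
proof (induction y rule: pgca_induct)
  case (single a c)
  then show ?case by (cases a; cases b) (auto simp: lookup_single when_def)
next
  case (add x y)
  then show ?case by (simp add: pgca_bracket_add_right lookup_add algebra_simps)
qed

section \<open>Coefficients of brackets with a basis vector\<close>

text \<open>
  These coefficients of \<open>[x, X\<^sub>n]\<close>, taken in degree \<open>j = 2 n\<close>, determine together every
  coefficient of \<open>x\<close> other than that of \<open>L\<^sub>0\<close>.
\<close>

lemma lookup_bracket_L_H:
  "Poly_Mapping.lookup (pgca_bracket x (Lg n)) (Hb j) =
     of_int (j - n) * Poly_Mapping.lookup x (Hb (j - n))"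
proof (induction x rule: pgca_induct)
  case (single a c)
  then show ?case by (cases a) (auto simp: lookup_single lookup_uminus when_def)
next
  case (add x y)
  then show ?case by (simp add: pgca_bracket_add_left lookup_add algebra_simps)
qed

lemma lookup_bracket_H:
  "Poly_Mapping.lookup (pgca_bracket x (Hg n)) (Hb j) =
     - of_int n * Poly_Mapping.lookup x (Lb (j - n))" (is ?H)
  "Poly_Mapping.lookup (pgca_bracket x (Hg n)) (Ib j) = Poly_Mapping.lookup x (Jb (j - n))"
  (is ?I)
  "Poly_Mapping.lookup (pgca_bracket x (Hg n)) (Jb j) = - Poly_Mapping.lookup x (Ib (j - n))"
  (is ?J)
proof -
  have "?H \<and> ?I \<and> ?J"
  proof (induction x rule: pgca_induct)
    case (single a c)
    then show ?case by (cases a) (auto simp: lookup_single lookup_uminus when_def)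
  next
    case (add x y)
    then show ?case by (simp add: pgca_bracket_add_left lookup_add algebra_simps)
  qed
  then show ?H ?I ?J by simp_all
qed

lemma lookup_bracket_I_J:
  "Poly_Mapping.lookup (pgca_bracket x (Ig n)) (Jb j) = Poly_Mapping.lookup x (Hb (j - n))"
proof (induction x rule: pgca_induct)
  case (single a c)
  then show ?case by (cases a) (auto simp: lookup_single lookup_uminus when_def)
next
  case (add x y)
  then show ?case by (simp add: pgca_bracket_add_left lookup_add algebra_simps)
qed

section \<open>Half-derivations\<close>

definition half_derivation :: "(pgca \<Rightarrow> pgca) \<Rightarrow> bool" where
  "half_derivation \<phi> \<longleftrightarrow>
     Vector_Spaces.linear pgca_scale pgca_scale \<phi> \<and>
     (\<forall>x y. pgca_scale 2 (\<phi> (pgca_bracket x y)) =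
        pgca_bracket (\<phi> x) y + pgca_bracket x (\<phi> y))"

lemma half_derivation_add: "half_derivation \<phi> \<Longrightarrow> \<phi> (x + y) = \<phi> x + \<phi> y"
  by (simp add: half_derivation_def Vector_Spaces.linear_iff)

lemma half_derivation_scale: "half_derivation \<phi> \<Longrightarrow> \<phi> (pgca_scale c x) = pgca_scale c (\<phi> x)"
  by (simp add: half_derivation_def Vector_Spaces.linear_iff)

lemma half_derivation_bracket:
  "half_derivation \<phi> \<Longrightarrow>
     pgca_scale 2 (\<phi> (pgca_bracket x y)) = pgca_bracket (\<phi> x) y + pgca_bracket x (\<phi> y)"
  by (simp add: half_derivation_def)

text \<open>
  Half-derivations form a vector space containing the identity, because
  \<open>[x,y] + [x,y] = 2 [x,y]\<close>.
\<close>

lemma half_derivation_minus_scalar: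
  assumes "half_derivation \<phi>"
  shows "half_derivation (\<lambda>x. \<phi> x - pgca_scale c x)"
  unfolding half_derivation_def Vector_Spaces.linear_iff
proof (intro conjI allI)
  fix x y
  show "pgca_scale 2 (\<phi> (pgca_bracket x y) - pgca_scale c (pgca_bracket x y)) =
      pgca_bracket (\<phi> x - pgca_scale c x) y + pgca_bracket x (\<phi> y - pgca_scale c y)"
  proof (rule poly_mapping_eqI)
    fix k
    have "2 * Poly_Mapping.lookup (\<phi> (pgca_bracket x y)) k =
        Poly_Mapping.lookup (pgca_bracket (\<phi> x) y + pgca_bracket x (\<phi> y)) k"
      by (simp flip: half_derivation_bracket[OF assms])
    then show "Poly_Mapping.lookup
        (pgca_scale 2 (\<phi> (pgca_bracket x y) - pgca_scale c (pgca_bracket x y))) k =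
      Poly_Mapping.lookup
        (pgca_bracket (\<phi> x - pgca_scale c x) y + pgca_bracket x (\<phi> y - pgca_scale c y)) k"
      unfolding diff_conv_add_uminus pgca_bracket_add_left pgca_bracket_add_right
        pgca_bracket_minus pgca_bracket_scale_left pgca_bracket_scale_right
      by (simp add: lookup_add lookup_uminus lookup_minus algebra_simps)
  qed
next
  fix b x
  show "\<phi> (pgca_scale b x) - pgca_scale c (pgca_scale b x) =
      pgca_scale b (\<phi> x - pgca_scale c x)"
    unfolding half_derivation_scale[OF assms]
    by (rule poly_mapping_eqI) (simp add: lookup_minus algebra_simps)
qed (simp_all add: pgca.vector_space_axioms half_derivation_add[OF assms]
    pgca.scale_right_distrib)

text \<open>
  This is the half-derivation identity for \<open>L\<^sub>0\<close> and a basis vector, read off coefficientwise: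
  both occurrences of \<open>L\<^sub>0\<close> act diagonally, and collecting the two eigenvalues leaves
  the factor \<open>degree b - 2 degree a\<close>.
\<close>

lemma half_derivation_lookup:
  assumes "half_derivation \<phi>"
  shows "of_int (degree b - 2 * degree a) *
      Poly_Mapping.lookup (\<phi> (Poly_Mapping.single a 1)) b =
    Poly_Mapping.lookup (pgca_bracket (\<phi> (Lg 0)) (Poly_Mapping.single a 1)) b"
proof -
  have L0: "pgca_bracket (Lg 0) (Poly_Mapping.single a 1) =
      pgca_scale (- of_int (degree a)) (Poly_Mapping.single a 1)"
    by (cases a) auto
  have "pgca_scale 2 (pgca_scale (- of_int (degree a)) (\<phi> (Poly_Mapping.single a 1))) =
      pgca_bracket (\<phi> (Lg 0)) (Poly_Mapping.single a 1) +
      pgca_bracket (Lg 0) (\<phi> (Poly_Mapping.single a 1))"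
    using half_derivation_bracket[OF assms, of "Lg 0" "Poly_Mapping.single a 1"]
    unfolding L0 half_derivation_scale[OF assms] .
  from arg_cong[OF this, of "\<lambda>x. Poly_Mapping.lookup x b"] show ?thesis
    by (simp add: lookup_add lookup_bracket_L0 algebra_simps)
qed

corollary half_derivation_resonance:
  assumes "half_derivation \<phi>" and "degree b = 2 * degree a"
  shows "Poly_Mapping.lookup (pgca_bracket (\<phi> (Lg 0)) (Poly_Mapping.single a 1)) b = 0"
  using half_derivation_lookup[OF assms(1), of b a] assms(2) by simp

text \<open>
  Each resonance condition isolates a single coefficient of \<open>\<phi> L\<^sub>0\<close>.  Pairing with \<open>H\<^sub>n\<close>
  removes all \<open>I\<close> and \<open>J\<close> coefficients and the \<open>L\<close> coefficients of nonzero index, pairing with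
  \<open>L\<^sub>n\<close> removes the \<open>H\<close> coefficients of nonzero index.  The element \<open>H\<^sub>0\<close>
  commutes with all \<open>L\<^sub>n\<close> and \<open>H\<^sub>n\<close>, so its coefficient needs a third family: it is detected
  by \<open>I\<^sub>0\<close>, since \<open>[H\<^sub>0, I\<^sub>0] = J\<^sub>0\<close>.
\<close>

lemma half_derivation_L0:
  assumes "half_derivation \<phi>"
  shows "\<phi> (Lg 0) = pgca_scale (Poly_Mapping.lookup (\<phi> (Lg 0)) (Lb 0)) (Lg 0)"
proof (rule poly_mapping_eqI)
  fix b
  note res = half_derivation_resonance[OF assms]
  show "Poly_Mapping.lookup (\<phi> (Lg 0)) b = Poly_Mapping.lookup
      (pgca_scale (Poly_Mapping.lookup (\<phi> (Lg 0)) (Lb 0)) (Lg 0)) b"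
  proof (cases b)
    case (Lb n)
    then show ?thesis using res[of "Hb (2 * n)" "Hb n"]
      by (cases "n = 0") (auto simp: lookup_bracket_H lookup_single when_def)
  next
    case (Hb n)
    then show ?thesis using res[of "Hb (2 * n)" "Lb n"] res[of "Jb 0" "Ib 0"]
      by (cases "n = 0")
        (auto simp: lookup_bracket_L_H lookup_bracket_I_J lookup_single when_def)
  next
    case (Ib n)
    then show ?thesis using res[of "Jb (2 * n)" "Hb n"]
      by (auto simp: lookup_bracket_H lookup_single when_def)
  next
    case (Jb n)
    then show ?thesis using res[of "Ib (2 * n)" "Hb n"]
      by (auto simp: lookup_bracket_H lookup_single when_def)
  qed
qed

section \<open>Half-derivations are scalar\<close>

lemma basis_vector_is_bracket:
  obtains m a c where "m \<noteq> 0" "degree a \<noteq> 0" "c \<noteq> 0"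
    "pgca_bracket (Lg m) (Poly_Mapping.single a 1) = Poly_Mapping.single b c"
proof -
  \<comment> \<open>With \<open>n > \<bar>k\<bar>\<close> and \<open>m = k - n\<close> one has \<open>m < 0 < n\<close>, so that \<open>m\<close>, \<open>n\<close> and \<open>m - n\<close> are
    all nonzero.\<close>
  define n where "n = \<bar>degree b\<bar> + 1"
  define m where "m = degree b - n"
  have mn: "m < 0" "n > 0" "m + n = degree b"
    by (auto simp: m_def n_def)
  have nz: "(of_int (m - n) :: complex) \<noteq> 0" "(- of_int n :: complex) \<noteq> 0"
    using mn by (simp_all only: of_int_eq_0_iff neg_equal_0_iff_equal)
  show ?thesis
  proof (cases b)
    case (Lb k)
    with mn nz show ?thesis by (intro that[of m "Lb n" "of_int (m - n)"]) auto
  next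
    case (Hb k)
    with mn nz show ?thesis by (intro that[of m "Hb n" "- of_int n"]) auto
  next
    case (Ib k)
    with mn nz show ?thesis by (intro that[of m "Ib n" "of_int (m - n)"]) auto
  next
    case (Jb k)
    with mn nz show ?thesis by (intro that[of m "Jb n" "of_int (m - n)"]) auto
  qed
qed

text \<open>
  Once \<open>\<phi> L\<^sub>0 = 0\<close>, the map \<open>\<phi>\<close> doubles degrees.  Evaluated at \<open>[L\<^sub>m, X\<^sub>n]\<close> with \<open>m\<close> and
  \<open>n\<close> nonzero, this places the two sides of the half-derivation identity in disjoint degrees.
\<close>

lemma half_derivation_L0_zero:
  assumes \<phi>: "half_derivation \<phi>" and L0: "\<phi> (Lg 0) = 0"
  shows "\<phi> x = 0"
proof -
  have doubles: "homogeneous (2 * degree a) (\<phi> (Poly_Mapping.single a 1))" for a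
    unfolding homogeneous_def
  proof (intro allI impI)
    fix b assume "degree b \<noteq> 2 * degree a"
    then have "of_int (degree b - 2 * degree a) \<noteq> (0 :: complex)"
      by (simp only: of_int_eq_0_iff)
    with half_derivation_lookup[OF \<phi>, of b a] L0
    show "Poly_Mapping.lookup (\<phi> (Poly_Mapping.single a 1)) b = 0"
      by (simp del: of_int_diff of_int_mult)
  qed
  have basis: "\<phi> (Poly_Mapping.single b 1) = 0" for b
  proof -
    obtain m a c where m: "m \<noteq> 0" and a: "degree a \<noteq> 0" and c: "c \<noteq> 0"
      and br: "pgca_bracket (Lg m) (Poly_Mapping.single a 1) = Poly_Mapping.single b c"
      by (rule basis_vector_is_bracket)
    let ?X = "Poly_Mapping.single a (1 :: complex)"
    have "homogeneous (m + degree a) (Poly_Mapping.single b c)"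
      using homogeneous_bracket[OF homogeneous_single[of "Lb m" 1] homogeneous_single[of a 1]] br
      by simp
    with c have deg: "degree b = m + degree a"
      by (auto simp: homogeneous_def lookup_single when_def split: if_splits)
    have *: "pgca_scale (2 * c) (\<phi> (Poly_Mapping.single b 1)) =
        pgca_bracket (\<phi> (Lg m)) ?X + pgca_bracket (Lg m) (\<phi> ?X)"
      using half_derivation_bracket[OF \<phi>, of "Lg m" ?X]
        half_derivation_scale[OF \<phi>, of c "Poly_Mapping.single b 1"] br by simp
    have h1: "homogeneous (2 * m + degree a) (pgca_bracket (\<phi> (Lg m)) ?X)"
      using homogeneous_bracket[OF doubles[of "Lb m"] homogeneous_single[of a 1]] by simp
    have h2: "homogeneous (m + 2 * degree a) (pgca_bracket (Lg m) (\<phi> ?X))"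
      using homogeneous_bracket[OF homogeneous_single[of "Lb m" 1] doubles[of a]] by simp
    show ?thesis
    proof (rule poly_mapping_eqI)
      fix d
      show "Poly_Mapping.lookup (\<phi> (Poly_Mapping.single b 1)) d = Poly_Mapping.lookup 0 d"
      proof (cases "degree d = 2 * degree b")
        case True
        with deg m a have "degree d \<noteq> 2 * m + degree a" "degree d \<noteq> m + 2 * degree a"
          by auto
        with h1 h2 c arg_cong[OF *, of "\<lambda>x. Poly_Mapping.lookup x d"] show ?thesis
          by (simp add: homogeneous_def lookup_add)
      next
        case False
        with doubles[of b] show ?thesis by (simp add: homogeneous_def)
      qed
    qed
  qed
  show ?thesis
  proof (induction x rule: pgca_induct)
    case (single a c)
    show ?case
      using half_derivation_scale[OF \<phi>, of c "Poly_Mapping.single a 1"] basis[of a] by simp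
  next
    case (add x y)
    then show ?case by (simp add: half_derivation_add[OF \<phi>])
  qed
qed

lemma half_derivation_is_scalar:
  assumes "half_derivation \<phi>"
  obtains c where "\<And>x. \<phi> x = pgca_scale c x"
proof -
  define c where "c = Poly_Mapping.lookup (\<phi> (Lg 0)) (Lb 0)"
  have "\<phi> (Lg 0) - pgca_scale c (Lg 0) = 0"
    unfolding c_def by (subst half_derivation_L0[OF assms]) (rule diff_self)
  then have "\<phi> x - pgca_scale c x = 0" for x
    by (rule half_derivation_L0_zero[OF half_derivation_minus_scalar[OF assms]])
  then show ?thesis by (intro that[of c]) simp
qed

section \<open>Transposed Poisson structures\<close>

theorem theorem3p7:
  fixes dot :: "pgca \<Rightarrow> pgca \<Rightarrow> pgca"
  assumes "transposed_poisson_structure pgca_scale pgca_bracket dot"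
  shows "trivial_product dot"
proof -
  interpret transposed_poisson_structure pgca_scale pgca_bracket dot by (fact assms)
  have "half_derivation (dot z)" for z
    using dot_bilinear transposed_leibniz[of z]
    by (simp add: half_derivation_def bilinear_op_def)
  then have "\<exists>c. \<forall>x. dot z x = pgca_scale c x" for z
    by (rule half_derivation_is_scalar) blast
  then obtain l where l: "\<And>z x. dot z x = pgca_scale (l z) x"
    by metis
  \<comment> \<open>Commutativity says that \<open>l z\<close> times \<open>x\<close> equals \<open>l x\<close> times \<open>z\<close>.  Comparing first with \<open>x = L\<^sub>0\<close>, \<open>z = L\<^sub>1\<close>, which are
    linearly independent, and then with \<open>x = L\<^sub>0\<close> and arbitrary \<open>z\<close> shows \<open>l = 0\<close>.\<close>
  have "pgca_scale (l (Lg 0)) (Lg 1) = pgca_scale (l (Lg 1)) (Lg 0)"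
    using dot_commute[of "Lg 0" "Lg 1"] by (simp only: l)
  from arg_cong[OF this, of "\<lambda>x. Poly_Mapping.lookup x (Lb 1)"] have l0: "l (Lg 0) = 0"
    by (simp add: lookup_single)
  have "l z = 0" for z
  proof -
    have "pgca_scale (l z) (Lg 0) = pgca_scale (l (Lg 0)) z"
      using dot_commute[of z "Lg 0"] by (simp only: l)
    from arg_cong[OF this, of "\<lambda>x. Poly_Mapping.lookup x (Lb 0)"] show ?thesis
      by (simp add: l0)
  qed
  then show ?thesis by (simp add: trivial_product_def l)
qed

end
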